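(* Let $G$ be a group, $N$ a normal subgroup, $\Gamma=G/N$, and $p\colon G\to\Gamma$ the projection. Let $\rho\colon G\to\mathrm{Homeo}_+(S^1)$ be a homomorphism such that $\rho^*e_{\mathbb{R}}$ is contained in the image of $p^*\colon\mathrm{H}^2(\Gamma;\mathbb{R})\to\mathrm{H}^2(G;\mathbb{R})$. Let $A\in C^2(\Gamma;\mathbb{R})$ be a normalized $2$-cocycle and $u\in C^1(G;\mathbb{R})$ with $\rho^*\chi_b-p^*A=\delta u$, and set $\mu_\rho=\nu_{\rho,A,u}=u|_N$. Then: (1) $\mu_\rho$ is a $G$-invariant homogeneous quasimorphism on $N$ with defect $D(\mu_\rho)\le1$. (2) For every positive integer $k$ and all $g_1,\dots,g_k\in G$, $w_1,\dots,w_k\in N$, $$\mu_\rho([g_1,w_1]\cdots[g_k,w_k])=-\tau_{\mathbb{R}}\bigl([\widetilde{\rho(g_1)},\widetilde{\rho(w_1)}]\cdots[\widetilde{\rho(g_k)},\widetilde{\rho(w_k)}]\bigr),$$ where $\widetilde{\rho(g_i)},\widetilde{\rho(w_i)}\in\widetilde{\mathcal{H}}_{\mathbb{R}}$ are (arbitrary) lifts of $\rho(g_i),\rho(w_i)$ for $i=1,\dots,k$.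
   Context: Write $[g,h]=ghg^{-1}h^{-1}$. A homogeneous quasimorphism on a group $K$ is a function $\mu\colon K\to\mathbb{R}$ with defect $D(\mu)=\sup_{g,h\in K}|\mu(gh)-\mu(g)-\mu(h)|<\infty$ and $\mu(g^n)=n\mu(g)$ for all $g\in K$, $n\in\mathbb{Z}$. A function $\mu$ on a normal subgroup $N$ of $G$ is $G$-invariant if $\mu(gxg^{-1})=\mu(x)$ for all $g\in G$, $x\in N$. $C^n(K;\mathbb{R})$ is the space of functions $K^n\to\mathbb{R}$ with the usual inhomogeneous coboundary $\delta$, e.g. $\delta u(g,h)=u(h)-u(gh)+u(g)$, and $\mathrm{H}^*(K;\mathbb{R})$ is its cohomology. A cocycle is normalized if it vanishes whenever one of its arguments is the identity. $S^1=\mathbb{R}/\mathbb{Z}$; $\mathrm{Homeo}_+(S^1)$ is its group of orientation preserving homeomorphisms. Let $T_r(x)=x+r$ on $\mathbb{R}$. $\widetilde{\mathcal{H}}$ is the group of homeomorphisms $\widetilde f\colon\mathbb{R}\to\mathbb{R}$ with $\widetilde f\circ T_1=T_1\circ\widetilde f$, with canonical projection $\pi\colon\widetilde{\mathcal{H}}\to\mathrm{Homeo}_+(S^1)$. The Poincaré translation number is $\tau(\widetilde f)=\lim_{n\to\infty}\widetilde f^n(0)/n$. The canonical bounded Euler cocycle is the bounded $2$-cocycle $\chi_b(f,g)=\tau(\widetilde f\widetilde g)-\tau(\widetilde f)-\tau(\widetilde g)$ for arbitrary lifts $\widetilde f,\widetilde g\in\widetilde{\mathcal{H}}$ of $f,g\in\mathrm{Homeo}_+(S^1)$.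 The real Euler class $e_{\mathbb{R}}\in\mathrm{H}^2(\mathrm{Homeo}_+(S^1);\mathbb{R})$ is the class of $\chi_b$. $\widetilde{\mathcal{H}}_{\mathbb{R}}$ is the quotient of $\widetilde{\mathcal{H}}\times\mathbb{R}$ by the relation $(\widetilde f,r)\sim(\widetilde f\circ T_1,r-1)$, with multiplication induced from $(\widetilde f,r)(\widetilde g,s)=(\widetilde f\widetilde g,r+s)$; it is a central $\mathbb{R}$-extension of $\mathrm{Homeo}_+(S^1)$ with projection $\pi((\widetilde f,r))=\pi(\widetilde f)$. The map $\tau_{\mathbb{R}}\colon\widetilde{\mathcal{H}}_{\mathbb{R}}\to\mathbb{R}$ is the well-defined map $\tau_{\mathbb{R}}((\widetilde f,r))=\tau(\widetilde f)+r$. *)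

theory Defs
  imports "HOL-Analysis.Analysis" "HOL-Algebra.Coset"
begin

section \<open>Commutators and quasimorphisms\<close>

definition commutator :: "('a, 'm) monoid_scheme \<Rightarrow> 'a \<Rightarrow> 'a \<Rightarrow> 'a" where
  "commutator G g h = g \<otimes>\<^bsub>G\<^esub> h \<otimes>\<^bsub>G\<^esub> inv\<^bsub>G\<^esub> g \<otimes>\<^bsub>G\<^esub> inv\<^bsub>G\<^esub> h"

text \<open>The ordered product of \<open>x 1\<close>, ..., \<open>x k\<close>.\<close>

definition ordered_prod :: "('a, 'm) monoid_scheme \<Rightarrow> (nat \<Rightarrow> 'a) \<Rightarrow> nat \<Rightarrow> 'a" where
  "ordered_prod G x k = foldr (\<otimes>\<^bsub>G\<^esub>) (map x [1..<Suc k]) \<one>\<^bsub>G\<^esub>"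

definition deviations :: "('a, 'm) monoid_scheme \<Rightarrow> ('a \<Rightarrow> real) \<Rightarrow> real set" where
  "deviations K \<mu> =
     {\<bar>\<mu> (g \<otimes>\<^bsub>K\<^esub> h) - \<mu> g - \<mu> h\<bar> | g h. g \<in> carrier K \<and> h \<in> carrier K}"

text \<open>Since \<open>Sup\<close> of an unbounded set of reals is unspecified, finiteness of the defect is the
  separate boundedness condition in \<open>homogeneous_quasimorphism\<close>.\<close>

definition defect :: "('a, 'm) monoid_scheme \<Rightarrow> ('a \<Rightarrow> real) \<Rightarrow> real" where
  "defect K \<mu> = Sup (deviations K \<mu>)"

definition homogeneous_quasimorphism :: "('a, 'm) monoid_scheme \<Rightarrow> ('a \<Rightarrow> real) \<Rightarrow> bool" where
  "homogeneous_quasimorphism K \<mu> \<longleftrightarrow>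
     bdd_above (deviations K \<mu>) \<and>
     (\<forall>g \<in> carrier K. \<forall>n::int. \<mu> (g [^]\<^bsub>K\<^esub> n) = of_int n * \<mu> g)"

definition invariant_under :: "('a, 'm) monoid_scheme \<Rightarrow> 'a set \<Rightarrow> ('a \<Rightarrow> real) \<Rightarrow> bool" where
  "invariant_under G N \<mu> \<longleftrightarrow>
     (\<forall>g \<in> carrier G. \<forall>x \<in> N. \<mu> (g \<otimes>\<^bsub>G\<^esub> x \<otimes>\<^bsub>G\<^esub> inv\<^bsub>G\<^esub> g) = \<mu> x)"


section \<open>Second group cohomology with real coefficients\<close>

text \<open>Cochains are total functions on the underlying type, and only their values on the carrier
  matter: cochains that agree on the carrier differ by the coboundary of 0, so the quotient
  \<open>H2\<close> is unaffected by the values outside.\<close>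

definition coboundary1 :: "('a, 'm) monoid_scheme \<Rightarrow> ('a \<Rightarrow> real) \<Rightarrow> 'a \<Rightarrow> 'a \<Rightarrow> real" where
  "coboundary1 K u g h = u h - u (g \<otimes>\<^bsub>K\<^esub> h) + u g"

definition coboundary2 ::
    "('a, 'm) monoid_scheme \<Rightarrow> ('a \<Rightarrow> 'a \<Rightarrow> real) \<Rightarrow> 'a \<Rightarrow> 'a \<Rightarrow> 'a \<Rightarrow> real" where
  "coboundary2 K c g h k = c h k - c (g \<otimes>\<^bsub>K\<^esub> h) k + c g (h \<otimes>\<^bsub>K\<^esub> k) - c g h"

definition cocycles2 :: "('a, 'm) monoid_scheme \<Rightarrow> ('a \<Rightarrow> 'a \<Rightarrow> real) set" where
  "cocycles2 K =
     {c. \<forall>g \<in> carrier K. \<forall>h \<in> carrier K. \<forall>k \<in> carrier K. coboundary2 K c g h k = 0}"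

definition normalized_cocycle2 :: "('a, 'm) monoid_scheme \<Rightarrow> ('a \<Rightarrow> 'a \<Rightarrow> real) \<Rightarrow> bool" where
  "normalized_cocycle2 K c \<longleftrightarrow>
     c \<in> cocycles2 K \<and> (\<forall>g \<in> carrier K. c \<one>\<^bsub>K\<^esub> g = 0 \<and> c g \<one>\<^bsub>K\<^esub> = 0)"

definition cohomologous2 ::
    "('a, 'm) monoid_scheme \<Rightarrow> (('a \<Rightarrow> 'a \<Rightarrow> real) \<times> ('a \<Rightarrow> 'a \<Rightarrow> real)) set" where
  "cohomologous2 K =
     {(c, d). c \<in> cocycles2 K \<and> d \<in> cocycles2 K \<and>
        (\<exists>u. \<forall>g \<in> carrier K. \<forall>h \<in> carrier K. c g h - d g h = coboundary1 K u g h)}"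

definition H2 :: "('a, 'm) monoid_scheme \<Rightarrow> ('a \<Rightarrow> 'a \<Rightarrow> real) set set" where
  "H2 K = cocycles2 K // cohomologous2 K"

definition H2_class ::
    "('a, 'm) monoid_scheme \<Rightarrow> ('a \<Rightarrow> 'a \<Rightarrow> real) \<Rightarrow> ('a \<Rightarrow> 'a \<Rightarrow> real) set" where
  "H2_class K c = cohomologous2 K `` {c}"

definition pullback2 :: "('a \<Rightarrow> 'b) \<Rightarrow> ('b \<Rightarrow> 'b \<Rightarrow> real) \<Rightarrow> 'a \<Rightarrow> 'a \<Rightarrow> real" where
  "pullback2 f c g h = c (f g) (f h)"

text \<open>The map \<open>f\<^sup>*\<close> on classes, for a homomorphism \<open>f\<close> with source \<open>K\<close>; all members of
  the union coincide.\<close>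

definition H2_pullback ::
    "('a, 'm) monoid_scheme \<Rightarrow> ('a \<Rightarrow> 'b) \<Rightarrow> ('b \<Rightarrow> 'b \<Rightarrow> real) set \<Rightarrow> ('a \<Rightarrow> 'a \<Rightarrow> real) set" where
  "H2_pullback K f X = (\<Union>c \<in> X. H2_class K (pullback2 f c))"


section \<open>The circle and its orientation preserving homeomorphisms\<close>

quotient_type circle = real / "\<lambda>x y :: real. x - y \<in> \<int>"
proof (rule equivpI)
  show "reflp (\<lambda>x y :: real. x - y \<in> \<int>)"
    by (simp add: reflp_def)
  show "symp (\<lambda>x y :: real. x - y \<in> \<int>)"
    by (metis (mono_tags, lifting) Ints_minus minus_diff_eq sympI)
  show "transp (\<lambda>x y :: real. x - y \<in> \<int>)"
    by (rule transpI) (metis Ints_add diff_add_cancel add_diff_eq)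
qed

definition to_circle :: "real \<Rightarrow> circle" where
  "to_circle = abs_circle"

lemma to_circle_eq_iff: "to_circle x = to_circle y \<longleftrightarrow> x - y \<in> \<int>"
  by (simp add: to_circle_def circle.abs_eq_iff)

lemma surj_to_circle: "surj to_circle"
  unfolding to_circle_def by (metis Quotient3_abs_rep Quotient3_circle surjI)

text \<open>The quotient topology.\<close>

instantiation circle :: topological_space
begin

definition open_circle :: "circle set \<Rightarrow> bool" where
  "open_circle U \<longleftrightarrow> open (to_circle -` U)"

instance
  by standard (auto simp: open_circle_def vimage_Union)

end

text \<open>A homeomorphism of the circle preserves the orientation if it lifts to an increasing map
  of the real line.\<close>

definition orientation_preserving :: "(circle \<Rightarrow> circle) \<Rightarrow> bool" where
  "orientation_preserving f \<longleftrightarrow>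
     (\<exists>F :: real \<Rightarrow> real. continuous_on UNIV F \<and> strict_mono F \<and>
        to_circle \<circ> F = f \<circ> to_circle)"

definition Homeo_plus :: "(circle \<Rightarrow> circle) monoid" where
  "Homeo_plus =
     \<lparr>carrier = {f. (\<exists>f'. homeomorphism UNIV UNIV f f') \<and> orientation_preserving f},
      monoid.mult = (\<circ>), one = id\<rparr>"

definition T :: "real \<Rightarrow> real \<Rightarrow> real" where
  "T r x = x + r"

definition Homeo_tilde :: "(real \<Rightarrow> real) monoid" where
  "Homeo_tilde =
     \<lparr>carrier = {F. (\<exists>F'. homeomorphism UNIV UNIV F F') \<and> F \<circ> T 1 = T 1 \<circ> F},
      monoid.mult = (\<circ>), one = id\<rparr>"

definition circle_proj :: "(real \<Rightarrow> real) \<Rightarrow> circle \<Rightarrow> circle" where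
  "circle_proj F = (THE f. f \<circ> to_circle = to_circle \<circ> F)"

definition translation_number :: "(real \<Rightarrow> real) \<Rightarrow> real" where
  "translation_number F = lim (\<lambda>n. (F ^^ n) 0 / real n)"

text \<open>The common value over all lifts.\<close>

definition euler_cocycle :: "(circle \<Rightarrow> circle) \<Rightarrow> (circle \<Rightarrow> circle) \<Rightarrow> real" where
  "euler_cocycle f g =
     (THE c. \<forall>F \<in> carrier Homeo_tilde. \<forall>G \<in> carrier Homeo_tilde.
        circle_proj F = f \<and> circle_proj G = g \<longrightarrow>
        c = translation_number (F \<circ> G) - translation_number F - translation_number G)"

definition real_euler_class :: "((circle \<Rightarrow> circle) \<Rightarrow> (circle \<Rightarrow> circle) \<Rightarrow> real) set" where
  "real_euler_class = H2_class Homeo_plus euler_cocycle"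


section \<open>The central extension by the reals\<close>

definition ext_step :: "(real \<Rightarrow> real) \<times> real \<Rightarrow> (real \<Rightarrow> real) \<times> real \<Rightarrow> bool" where
  "ext_step x y \<longleftrightarrow>
     (\<exists>F \<in> carrier Homeo_tilde. \<exists>r. x = (F, r) \<and> y = (F \<circ> T 1, r - 1))"

definition ext_rel :: "(((real \<Rightarrow> real) \<times> real) \<times> ((real \<Rightarrow> real) \<times> real)) set" where
  "ext_rel = {(x, y). equivclp ext_step x y}"

text \<open>In the following definitions, all members of the union coincide, and the defining
  property of \<open>THE\<close> does not depend on the representative.\<close>

definition Homeo_tilde_R :: "((real \<Rightarrow> real) \<times> real) set monoid" where
  "Homeo_tilde_R =
     \<lparr>carrier = (carrier Homeo_tilde \<times> UNIV) // ext_rel,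
      monoid.mult = (\<lambda>X Y. \<Union>(F, r) \<in> X. \<Union>(G, s) \<in> Y. ext_rel `` {(F \<circ> G, r + s)}),
      one = ext_rel `` {(id, 0)}\<rparr>"

definition ext_proj :: "((real \<Rightarrow> real) \<times> real) set \<Rightarrow> circle \<Rightarrow> circle" where
  "ext_proj X = (THE f. \<forall>(F, r) \<in> X. f = circle_proj F)"

definition tau_R :: "((real \<Rightarrow> real) \<times> real) set \<Rightarrow> real" where
  "tau_R X = (THE t. \<forall>(F, r) \<in> X. t = translation_number F + r)"

end

theory Submission
  imports Defs
begin

text \<open>
  Pull the Euler cocycle back to the central extension \<open>Homeo_tilde_R\<close>. There it becomes a
  coboundary, with primitive \<open>- tau_R\<close> (\<open>euler_cocycle_tau_R\<close>). On the other hand, \<open>\<rho>\<^sup>*\<chi>\<^sub>b\<close> and \<open>\<delta>u\<close>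
  agree on pairs with a member in \<open>N\<close>, because their difference \<open>p\<^sup>*A\<close> is normalized. So \<open>u\<close> on \<open>N\<close> and
  \<open>- tau_R\<close> on lifts fail to be additive by exactly the same amount (\<open>u_mult\<close>), and the properties of \<open>u\<close> are
  inherited from \<open>tau_R\<close>: the translation number is a conjugation invariant homogeneous
  quasimorphism of defect at most 1, hence so is \<open>u\<close> on \<open>N\<close>, with invariance under all of \<open>G\<close>
  (\<open>u_conj\<close>, \<open>u_int_pow\<close>).

  For the commutator formula, \<open>u\<close> and \<open>- tau_R\<close> need not agree on \<open>w\<close> and an arbitrary lift of it. They do
  agree on \<open>[g, w]\<close> and the commutator of the lifts, because \<open>[g, w]\<close> is a conjugate of \<open>w\<close> times
  the inverse of \<open>w\<close> and the two contributions cancel (\<open>u_commutator\<close>). Once \<open>u\<close> and \<open>- tau_R\<close> agree on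
  some elements of \<open>N\<close> with chosen lifts, they agree on their products (\<open>u_ordered_prod\<close>).

  The dynamical input is the sharp bound \<open>\<tau>(F G) \<le> \<tau>(F) + \<tau>(G) + 1\<close> (\<open>translation_number_compose_le\<close>).
  Each \<open>F\<close> admits a monotone coordinate on the line, commuting with the unit translation, in
  which \<open>F\<close> advances every point by at most \<open>\<tau>(F)\<close> (\<open>exists_subconjugacy\<close>). The lengths of an
  interval measured in two such coordinates differ by at most 1, which bounds the advance of \<open>F G\<close> in
  the coordinate of \<open>F\<close>.

  Two facts about the circle connect this with the definitions: every element of \<open>Homeo_plus\<close> has a
  lift in \<open>Homeo_tilde\<close> (\<open>Homeo_plus_lift\<close>), and two lifts differ by an integer
  translation (\<open>circle_proj_eq_iff\<close>), so \<open>euler_cocycle\<close>, \<open>ext_proj\<close> and \<open>tau_R\<close> can be computed from any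
  representative.
\<close>

section \<open>Translation numbers of degree one maps\<close>

text \<open>The lifts of circle homeomorphisms to the line are degree one maps, but the auxiliary function
  in the proof of \<open>translation_number_compose_le\<close> is a supremum of such lifts and need be neither
  continuous nor injective. Monotonicity and periodicity are all that the estimates use, so they are
  isolated here.\<close>

definition degree_one :: "(real \<Rightarrow> real) \<Rightarrow> bool" where
  "degree_one F \<longleftrightarrow> mono F \<and> (\<forall>x. F (x + 1) = F x + 1)"

lemma degree_one_add_int:
  assumes "degree_one F" shows "F (x + of_int n) = F x + of_int n"
proof (induction n rule: int_induct [where k = 0])
  case (step1 i)
  have "F (x + of_int (i + 1)) = F ((x + of_int i) + 1)" by (simp add: add.assoc)
  also have "\<dots> = F (x + of_int i) + 1" using assms by (simp only: degree_one_def)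
  finally show ?case using step1 by simp
next
  case (step2 i)
  have "F (x + of_int i) = F ((x + of_int (i - 1)) + 1)" by simp
  also have "\<dots> = F (x + of_int (i - 1)) + 1" using assms by (simp only: degree_one_def)
  finally show ?case using step2 by simp
qed simp

lemma degree_one_id: "degree_one id"
  by (simp add: degree_one_def mono_def)

lemma degree_one_compose: "degree_one F \<Longrightarrow> degree_one G \<Longrightarrow> degree_one (F \<circ> G)"
  by (simp add: degree_one_def mono_def)

lemma degree_one_funpow: "degree_one F \<Longrightarrow> degree_one (F ^^ n)"
  by (induction n) (simp_all add: degree_one_id degree_one_compose)

text \<open>Round \<open>y - x\<close> down to an integer \<open>n\<close>: both increments lie between \<open>n\<close> and \<open>n + 1\<close>. The point
  of comparing two different maps directly is that the error is 1, whereas comparing each of them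
  with the identity would lose 2.\<close>

lemma degree_one_increment_le:
  assumes "degree_one h" "degree_one k"
  shows "h y - h x \<le> k y - k x + 1"
proof -
  define n where "n = \<lfloor>y - x\<rfloor>"
  have n: "x + of_int n \<le> y" "y \<le> x + of_int (n + 1)"
    unfolding n_def by linarith+
  have "h y \<le> h (x + of_int (n + 1))"
    using assms(1) n by (simp add: degree_one_def mono_def)
  moreover have "k (x + of_int n) \<le> k y"
    using assms(2) n by (simp add: degree_one_def mono_def)
  ultimately show ?thesis
    by (simp only: degree_one_add_int[OF assms(1)] degree_one_add_int[OF assms(2)])
qed

lemma degree_one_increment_close:
  assumes "degree_one h" shows "\<bar>h y - h x - (y - x)\<bar> \<le> 1"
  using degree_one_increment_le[OF assms degree_one_id, of y x]
    degree_one_increment_le[OF degree_one_id assms, of y x] by simp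

text \<open>The additive analogue of the Fekete lemma: \<open>a (m * n)\<close> differs from \<open>n * a m\<close> by at most \<open>n\<close> and from
  \<open>m * a n\<close> by at most \<open>m\<close>, so the averages form a Cauchy sequence with an explicit rate.\<close>

lemma quasi_additive_limit:
  fixes a :: "nat \<Rightarrow> real"
  assumes "\<And>m n. \<bar>a (m + n) - a m - a n\<bar> \<le> 1"
  obtains t where "(\<lambda>n. a n / real n) \<longlonglongrightarrow> t" "\<And>n. \<bar>a n - real n * t\<bar> \<le> 1"
proof -
  have mult: "\<bar>a (n * m) - real n * a m\<bar> \<le> real n" if "n > 0" for n m
    using that
  proof (induction n)
    case (Suc n)
    then show ?case using assms[of m "n * m"] by (cases n) (simp_all add: algebra_simps)
  qed simp
  have close: "\<bar>a m / real m - a n / real n\<bar> \<le> 1 / real m + 1 / real n" if "m > 0" "n > 0" for m n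
  proof -
    have "\<bar>real n * a m - real m * a n\<bar> \<le> real n + real m"
      using mult[OF \<open>n > 0\<close>, of m] mult[OF \<open>m > 0\<close>, of n] by (simp add: mult.commute[of n m])
    moreover have "a m / real m - a n / real n = (real n * a m - real m * a n) / (real m * real n)"
      using that by (simp add: field_simps)
    moreover have "1 / real m + 1 / real n = (real n + real m) / (real m * real n)"
      using that by (simp add: field_simps)
    ultimately show ?thesis
      using that by (simp add: abs_mult divide_right_mono)
  qed
  have "Cauchy (\<lambda>n. a n / real n)"
  proof (rule metric_CauchyI)
    fix e :: real assume "e > 0"
    then obtain M where M: "real M > 2 / e" using reals_Archimedean2 by blast
    have pos: "real M > 0" using M \<open>e > 0\<close> by (meson divide_pos_pos less_trans zero_less_numeral)
    have "dist (a m / real m) (a n / real n) < e" if "m \<ge> M" "n \<ge> M" for m n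
    proof -
      have "1 / real m \<le> 1 / real M" "1 / real n \<le> 1 / real M"
        using that pos by (simp_all add: frac_le)
      moreover have "2 / real M < e" using M pos \<open>e > 0\<close> by (simp add: field_simps)
      ultimately show ?thesis
        using close[of m n] that pos by (simp add: dist_real_def)
    qed
    then show "\<exists>M. \<forall>m\<ge>M. \<forall>n\<ge>M. dist (a m / real m) (a n / real n) < e" by blast
  qed
  then obtain t where t: "(\<lambda>n. a n / real n) \<longlonglongrightarrow> t"
    using Cauchy_convergent_iff convergent_def by blast
  have "\<bar>a n - real n * t\<bar> \<le> 1" for n
  proof (cases "n = 0")
    case True
    then show ?thesis using assms[of 0 0] by simp
  next
    case False
    have "(\<lambda>m. \<bar>a n / real n - a m / real m\<bar>) \<longlonglongrightarrow> \<bar>a n / real n - t\<bar>"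
      by (intro tendsto_intros t)
    moreover have "(\<lambda>m. 1 / real n + 1 / real m) \<longlonglongrightarrow> 1 / real n + 0"
      by (intro tendsto_intros lim_1_over_n)
    ultimately have "\<bar>a n / real n - t\<bar> \<le> 1 / real n + 0"
      by (rule LIMSEQ_le) (use close False in \<open>auto intro!: exI[of _ 1]\<close>)
    moreover have "a n - real n * t = (a n / real n - t) * real n"
      using False by (simp add: field_simps)
    ultimately show ?thesis
      using False by (simp add: abs_mult field_simps)
  qed
  with t that show ?thesis by blast
qed

lemma translation_number_bound_0:
  assumes "degree_one F"
  shows "\<bar>(F ^^ n) 0 - real n * translation_number F\<bar> \<le> 1"
proof -
  have "\<bar>(F ^^ (m + n)) 0 - (F ^^ m) 0 - (F ^^ n) 0\<bar> \<le> 1" for m n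
    using degree_one_increment_close[OF degree_one_funpow[OF assms], of m "(F ^^ n) 0" 0]
    by (simp add: funpow_add algebra_simps)
  then obtain t where t: "(\<lambda>n. (F ^^ n) 0 / real n) \<longlonglongrightarrow> t" "\<And>n. \<bar>(F ^^ n) 0 - real n * t\<bar> \<le> 1"
    using quasi_additive_limit[of "\<lambda>n. (F ^^ n) 0"] by blast
  then show ?thesis unfolding translation_number_def using limI by blast
qed

text \<open>The orbit of any point stays at bounded distance from an arithmetic progression. This
  characterizes the translation number, so later computations only have to exhibit such a
  bound, and never return to the limit in the definition.\<close>

lemma translation_number_bound:
  assumes "degree_one F"
  shows "\<bar>(F ^^ n) x - x - real n * translation_number F\<bar> \<le> 2"
  using translation_number_bound_0[OF assms, of n]
    degree_one_increment_close[OF degree_one_funpow[OF assms], of n x 0] by linarith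

lemma bounded_multiples_nonpos:
  fixes s :: real
  assumes "\<And>n. real n * s \<le> C"
  shows "s \<le> 0"
proof (rule ccontr)
  assume "\<not> s \<le> 0"
  then obtain n where "real n * s > C" using reals_Archimedean3[of s] by auto
  with assms[of n] show False by simp
qed

lemma translation_number_le:
  assumes "degree_one F" "\<And>n. (F ^^ n) x \<le> real n * t + C"
  shows "translation_number F \<le> t"
proof -
  have "real n * (translation_number F - t) \<le> C + 2 - x" for n
    using assms(2)[of n] translation_number_bound[OF assms(1), of n x]
    by (simp add: right_diff_distrib)
  then show ?thesis using bounded_multiples_nonpos by force
qed

lemma translation_number_eqI:
  assumes "degree_one F" "\<And>n. \<bar>(F ^^ n) x - real n * t\<bar> \<le> C"
  shows "translation_number F = t"
proof -
  have "real n * (translation_number F - t) \<le> C + 2 + \<bar>x\<bar>" 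
       "real n * (t - translation_number F) \<le> C + 2 + \<bar>x\<bar>" for n
    using assms(2)[of n] translation_number_bound[OF assms(1), of n x]
    unfolding right_diff_distrib by linarith+
  then show ?thesis using bounded_multiples_nonpos by (metis diff_le_0_iff_le order_antisym)
qed

text \<open>The map \<open>h\<close> carries orbits of \<open>F\<close> to orbits of \<open>K\<close> and moves points by a bounded amount.\<close>

lemma translation_number_semiconj:
  assumes "degree_one h" "degree_one F" "degree_one K" "h \<circ> F = K \<circ> h"
  shows "translation_number K = translation_number F"
proof (rule translation_number_eqI[OF assms(3), where x = "h 0"])
  fix n
  have "(K ^^ n) (h x) = h ((F ^^ n) x)" for x
    by (induction n) (use assms(4) in \<open>simp_all add: fun_eq_iff\<close>)
  then show "\<bar>(K ^^ n) (h 0) - real n * translation_number F\<bar> \<le> 2 + \<bar>h 0\<bar>"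
    using degree_one_increment_close[OF assms(1), of "(F ^^ n) 0" 0]
      translation_number_bound_0[OF assms(2), of n] by simp
qed

lemma translation_number_commuting:
  assumes "degree_one F" "degree_one G" "F \<circ> G = G \<circ> F"
  shows "translation_number (F \<circ> G) = translation_number F + translation_number G"
proof (rule translation_number_eqI[OF degree_one_compose[OF assms(1,2)], where x = 0])
  fix n
  have comm: "(F ^^ n) (G x) = G ((F ^^ n) x)" for n x
    by (induction n) (use assms(3) in \<open>simp_all add: fun_eq_iff\<close>)
  have "((F \<circ> G) ^^ n) x = (F ^^ n) ((G ^^ n) x)" for x
    by (induction n) (simp_all add: comm)
  then show "\<bar>((F \<circ> G) ^^ n) 0 - real n * (translation_number F + translation_number G)\<bar> \<le> 3"
    using degree_one_increment_close[OF degree_one_funpow[OF assms(1)], of n "(G ^^ n) 0" 0]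
      translation_number_bound_0[OF assms(1), of n] translation_number_bound_0[OF assms(2), of n]
    by (simp add: distrib_left)
qed

lemma translation_number_T: "translation_number (T r) = r"
proof (rule translation_number_eqI)
  show "degree_one (T r)" by (simp add: degree_one_def mono_def T_def)
  show "\<bar>(T r ^^ n) 0 - real n * r\<bar> \<le> 0" for n
    by (induction n) (simp_all add: T_def algebra_simps)
qed

lemma translation_number_id: "translation_number id = 0"
  using translation_number_T[of 0] by (simp add: T_def[abs_def] id_def)

text \<open>Up to a monotone change of coordinate, \<open>F\<close> moves no point forward by more than \<open>\<tau>(F)\<close>.
  The coordinate \<open>h\<close> is the supremum over the forward orbit of the deviations \<open>F\<^sup>n x - n \<tau>(F)\<close>, which
  are bounded. Replacing \<open>x\<close> by \<open>F x\<close> drops the term \<open>n = 0\<close> from the supremum and shifts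
  the others by \<open>\<tau>(F)\<close>.\<close>

lemma exists_subconjugacy:
  assumes "degree_one F"
  obtains h where "degree_one h" "\<And>x. h (F x) \<le> h x + translation_number F"
proof -
  define a where "a = translation_number F"
  define h where "h x = (SUP n. (F ^^ n) x - real n * a)" for x
  have bdd: "bdd_above (range (\<lambda>n. (F ^^ n) x - real n * a))" for x
  proof (rule bdd_aboveI2)
    show "(F ^^ n) x - real n * a \<le> x + 2" for n
      using translation_number_bound[OF assms, of n x] unfolding a_def by linarith
  qed
  have le: "(F ^^ n) x - real n * a \<le> h x" for n x
    unfolding h_def by (rule cSUP_upper[OF _ bdd]) simp
  have least: "h x \<le> c" if "\<And>n. (F ^^ n) x - real n * a \<le> c" for x c
    unfolding h_def by (rule cSUP_least) (use that in auto)
  have pow: "degree_one (F ^^ n)" for n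
    using assms by (rule degree_one_funpow)
  have "mono h"
  proof
    fix x y :: real assume "x \<le> y"
    then have "(F ^^ n) x \<le> (F ^^ n) y" for n
      using pow by (simp add: degree_one_def mono_def)
    then show "h x \<le> h y"
      by (intro least) (meson diff_right_mono le order_trans)
  qed
  moreover have "h (x + 1) = h x + 1" for x
  proof (rule antisym)
    have shift: "(F ^^ n) (x + 1) = (F ^^ n) x + 1" for n
      using pow by (simp add: degree_one_def)
    show "h (x + 1) \<le> h x + 1"
      by (rule least) (use le[of _ x] shift in \<open>simp add: algebra_simps\<close>)
    have "h x \<le> h (x + 1) - 1"
      by (rule least) (use le[of _ "x + 1"] shift in \<open>simp add: algebra_simps\<close>)
    then show "h x + 1 \<le> h (x + 1)" by simp
  qed
  moreover have "h (F x) \<le> h x + a" for x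
    \<comment> \<open>The \<open>n\<close>-th term for \<open>F x\<close> is the term \<open>n + 1\<close> for \<open>x\<close>, up to the summand \<open>a\<close>.\<close>
    by (rule least) (use le[of "Suc _" x] in \<open>simp add: algebra_simps funpow_swap1\<close>)
  ultimately show ?thesis
    using that unfolding degree_one_def a_def by blast
qed

text \<open>In the coordinate \<open>k\<close> the map \<open>G\<close> advances by at most \<open>\<tau>(G)\<close>, hence in the coordinate \<open>h\<close> adapted to
  \<open>F\<close> it advances by at most \<open>\<tau>(G) + 1\<close>, and then \<open>F\<close> adds at most \<open>\<tau>(F)\<close>. This is where the sharp
  constant 1 comes from.\<close>

lemma translation_number_compose_le:
  assumes "degree_one F" "degree_one G"
  shows "translation_number (F \<circ> G) \<le> translation_number F + translation_number G + 1"
proof -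
  define t where "t = translation_number F + translation_number G + 1"
  obtain h where h: "degree_one h" "\<And>x. h (F x) \<le> h x + translation_number F"
    using exists_subconjugacy[OF assms(1)] by blast
  obtain k where k: "degree_one k" "\<And>x. k (G x) \<le> k x + translation_number G"
    using exists_subconjugacy[OF assms(2)] by blast
  have step: "h (F (G x)) \<le> h x + t" for x
    using h(2)[of "G x"] k(2)[of x] degree_one_increment_le[OF h(1) k(1), of "G x" x]
    unfolding t_def by linarith
  have iter: "h (((F \<circ> G) ^^ n) 0) \<le> h 0 + real n * t" for n
  proof (induction n)
    case (Suc n)
    have "h (F (G (((F \<circ> G) ^^ n) 0))) \<le> h 0 + real (Suc n) * t"
      using step[of "((F \<circ> G) ^^ n) 0"] Suc unfolding of_nat_Suc distrib_right by linarith
    moreover have "((F \<circ> G) ^^ Suc n) 0 = F (G (((F \<circ> G) ^^ n) 0))" by simp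
    ultimately show ?case by metis
  qed simp
  show ?thesis unfolding t_def[symmetric]
  proof (rule translation_number_le[OF degree_one_compose[OF assms]])
    show "((F \<circ> G) ^^ n) 0 \<le> real n * t + 1" for n
      using iter[of n] degree_one_increment_close[OF h(1), of "((F \<circ> G) ^^ n) 0" 0] by linarith
  qed
qed


section \<open>Lifts of circle homeomorphisms and the Euler cocycle\<close>

lemma Homeo_tilde_mult: "F \<otimes>\<^bsub>Homeo_tilde\<^esub> G = F \<circ> G"
  and Homeo_tilde_one: "\<one>\<^bsub>Homeo_tilde\<^esub> = id"
  and Homeo_plus_mult: "f \<otimes>\<^bsub>Homeo_plus\<^esub> g = f \<circ> g"
  by (simp_all add: Homeo_tilde_def Homeo_plus_def)

lemma Homeo_tilde_commute_T: "F \<in> carrier Homeo_tilde \<Longrightarrow> F (x + 1) = F x + 1"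
  by (auto simp: Homeo_tilde_def T_def fun_eq_iff)

lemma Homeo_tilde_homeomorphism:
  assumes "F \<in> carrier Homeo_tilde"
  obtains F' where "homeomorphism UNIV UNIV F F'"
  using assms by (auto simp: Homeo_tilde_def)

lemma Homeo_tilde_continuous: "F \<in> carrier Homeo_tilde \<Longrightarrow> continuous_on UNIV F"
  by (auto simp: Homeo_tilde_def homeomorphism_def)

text \<open>An injective continuous map of the line is strictly monotone, and commuting with the unit
  translation rules out the decreasing case.\<close>

lemma Homeo_tilde_strict_mono:
  assumes F: "F \<in> carrier Homeo_tilde"
  shows "strict_mono F"
proof -
  obtain F' where F': "homeomorphism UNIV UNIV F F'"
    using F by (rule Homeo_tilde_homeomorphism)
  have "inj F"
    using F' by (metis UNIV_I homeomorphism_apply1 injI)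
  then have "strict_mono F \<or> strict_antimono_on UNIV F"
    using injective_eq_monotone_map[of UNIV F] Homeo_tilde_continuous[OF F] by simp
  moreover have "\<not> strict_antimono_on UNIV F"
    using Homeo_tilde_commute_T[OF F, of 0] by (auto dest: monotone_onD[where x = 0 and y = 1])
  ultimately show ?thesis by blast
qed

lemma Homeo_tilde_degree_one: "F \<in> carrier Homeo_tilde \<Longrightarrow> degree_one F"
  by (simp add: degree_one_def Homeo_tilde_commute_T Homeo_tilde_strict_mono strict_mono_mono)

lemma T_int_in_Homeo_tilde: "T (of_int n) \<in> carrier Homeo_tilde"
proof -
  have "homeomorphism UNIV UNIV (T (of_int n)) (T (- of_int n))"
    by (rule homeomorphismI) (auto simp: T_def intro!: continuous_intros)
  then show ?thesis by (auto simp: Homeo_tilde_def T_def fun_eq_iff)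
qed

lemma Homeo_tilde_commute_T_int:
  "F \<in> carrier Homeo_tilde \<Longrightarrow> F \<circ> T (of_int n) = T (of_int n) \<circ> F"
  by (simp add: fun_eq_iff T_def degree_one_add_int Homeo_tilde_degree_one)

lemma group_Homeo_tilde: "group Homeo_tilde"
proof (rule groupI, unfold Homeo_tilde_mult Homeo_tilde_one)
  show "id \<in> carrier Homeo_tilde"
    using T_int_in_Homeo_tilde[of 0] by (simp add: T_def[abs_def] id_def)
next
  fix F G assume F: "F \<in> carrier Homeo_tilde" and G: "G \<in> carrier Homeo_tilde"
  obtain F' G' where "homeomorphism UNIV UNIV F F'" "homeomorphism UNIV UNIV G G'"
    using F G by (meson Homeo_tilde_homeomorphism)
  then have "homeomorphism UNIV UNIV (F \<circ> G) (G' \<circ> F')"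
    using homeomorphism_compose by blast
  moreover have "(F \<circ> G) \<circ> T 1 = T 1 \<circ> (F \<circ> G)"
    using F G by (simp add: fun_eq_iff T_def Homeo_tilde_commute_T)
  ultimately show "F \<circ> G \<in> carrier Homeo_tilde"
    by (auto simp: Homeo_tilde_def)
next
  fix F assume F: "F \<in> carrier Homeo_tilde"
  obtain F' where F': "homeomorphism UNIV UNIV F F'"
    using F by (rule Homeo_tilde_homeomorphism)
  then have inv: "F' (F x) = x" "F (F' x) = x" for x
    by (simp_all add: homeomorphism_def)
  have "F' (x + 1) = F' x + 1" for x
    using Homeo_tilde_commute_T[OF F, of "F' x"] inv by metis
  then have "F' \<in> carrier Homeo_tilde"
    using homeomorphism_symD[OF F'] by (auto simp: Homeo_tilde_def T_def fun_eq_iff)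
  moreover have "F' \<circ> F = id" by (simp add: fun_eq_iff inv)
  ultimately show "\<exists>F'\<in>carrier Homeo_tilde. F' \<circ> F = id" by blast
qed (simp_all add: comp_assoc)

lemma id_in_Homeo_tilde: "id \<in> carrier Homeo_tilde"
  using monoid.one_closed[OF group.is_monoid[OF group_Homeo_tilde]]
  unfolding Homeo_tilde_one .

lemma Homeo_tilde_compose_closed:
  "F \<in> carrier Homeo_tilde \<Longrightarrow> G \<in> carrier Homeo_tilde \<Longrightarrow> F \<circ> G \<in> carrier Homeo_tilde"
  using monoid.m_closed[OF group.is_monoid[OF group_Homeo_tilde]] unfolding Homeo_tilde_mult .

lemma Homeo_tilde_inverse:
  assumes "F \<in> carrier Homeo_tilde"
  obtains F' where "F' \<in> carrier Homeo_tilde" "F' \<circ> F = id" "F \<circ> F' = id"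
  using group.inv_closed[OF group_Homeo_tilde assms] group.l_inv[OF group_Homeo_tilde assms]
    group.r_inv[OF group_Homeo_tilde assms] that
  unfolding Homeo_tilde_mult Homeo_tilde_one by blast

lemma circle_map_eqI: "f \<circ> to_circle = g \<circ> to_circle \<Longrightarrow> f = g"
  using surj_to_circle by (metis comp_apply ext surjD)

lemma circle_proj_to_circle:
  assumes "F \<in> carrier Homeo_tilde"
  shows "circle_proj F \<circ> to_circle = to_circle \<circ> F"
proof -
  define f where "f c = to_circle (F (SOME x. to_circle x = c))" for c
  have f: "f \<circ> to_circle = to_circle \<circ> F"
  proof
    fix x
    define y where "y = (SOME y. to_circle y = to_circle x)"
    have "to_circle y = to_circle x" unfolding y_def by (rule someI) simp
    then obtain n where "y = x + of_int n"
      by (metis Ints_cases add.commute diff_add_cancel to_circle_eq_iff)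
    then have "F y - F x \<in> \<int>"
      using degree_one_add_int[OF Homeo_tilde_degree_one[OF assms]] by simp
    then show "(f \<circ> to_circle) x = (to_circle \<circ> F) x"
      unfolding comp_apply f_def y_def[symmetric] by (simp add: to_circle_eq_iff)
  qed
  show ?thesis unfolding circle_proj_def
  proof (rule theI[of _ f])
    show "g = f" if "g \<circ> to_circle = to_circle \<circ> F" for g
      using that f by (metis circle_map_eqI)
  qed (rule f)
qed

lemma circle_proj_eqI:
  "F \<in> carrier Homeo_tilde \<Longrightarrow> f \<circ> to_circle = to_circle \<circ> F \<Longrightarrow> circle_proj F = f"
  by (rule circle_map_eqI) (simp add: circle_proj_to_circle)

text \<open>The difference of two lifts is continuous and integer valued, hence constant.\<close>

lemma circle_proj_eq_iff:
  assumes F: "F \<in> carrier Homeo_tilde" and G: "G \<in> carrier Homeo_tilde"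
  shows "circle_proj F = circle_proj G \<longleftrightarrow> (\<exists>n. G = F \<circ> T (of_int n))"
proof
  assume eq: "circle_proj F = circle_proj G"
  have int: "G x - F x \<in> \<int>" for x
    using circle_proj_to_circle[OF F] circle_proj_to_circle[OF G] eq
    by (metis comp_apply to_circle_eq_iff)
  have "(\<lambda>x. G x - F x) constant_on UNIV"
  proof (rule continuous_discrete_range_constant)
    show "continuous_on UNIV (\<lambda>x. G x - F x)"
      by (intro continuous_intros Homeo_tilde_continuous F G)
    have "1 \<le> norm ((G y - F y) - (G x - F x))" if "G y - F y \<noteq> G x - F x" for x y
    proof -
      have "(G y - F y) - (G x - F x) \<in> \<int>" using int by (simp only: Ints_diff)
      then show ?thesis using that Ints_nonzero_abs_ge1 by force
    qed
    then show "\<exists>e>0. \<forall>y. y \<in> UNIV \<and> G y - F y \<noteq> G x - F x \<longrightarrow> e \<le> norm ((G y - F y) - (G x - F x))" for x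
      by (intro exI[of _ 1]) auto
  qed simp
  then obtain c where c: "\<And>x. G x - F x = c" by (auto simp: constant_on_def)
  obtain n where "c = of_int n" using int[of 0] c by (auto elim: Ints_cases)
  then have "G = F \<circ> T (of_int n)"
    using c by (auto simp: fun_eq_iff T_def degree_one_add_int[OF Homeo_tilde_degree_one[OF F]] algebra_simps)
  then show "\<exists>n. G = F \<circ> T (of_int n)" ..
next
  assume "\<exists>n. G = F \<circ> T (of_int n)"
  then obtain n where n: "G = F \<circ> T (of_int n)" ..
  have "to_circle \<circ> G = to_circle \<circ> F"
    by (auto simp: n fun_eq_iff T_def to_circle_eq_iff degree_one_add_int[OF Homeo_tilde_degree_one[OF F]])
  then show "circle_proj F = circle_proj G" by (simp add: circle_proj_def)
qed

text \<open>A continuous increasing lift \<open>F\<close> of a homeomorphism \<open>f\<close> satisfies \<open>F (x + 1) = F x + n\<close> with an integer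
  \<open>n > 0\<close>. If \<open>n\<close> were larger than 1, then by the intermediate value theorem \<open>F\<close> would take the value
  \<open>F x + 1\<close> strictly between \<open>x\<close> and \<open>x + 1\<close>, against the injectivity of \<open>f\<close>. So \<open>F\<close> commutes with
  the unit translation, and it is surjective because it is unbounded in both directions.\<close>

lemma Homeo_plus_lift:
  assumes f: "f \<in> carrier Homeo_plus"
  obtains F where "F \<in> carrier Homeo_tilde" "circle_proj F = f"
proof -
  obtain f' where f': "homeomorphism UNIV UNIV f f'"
    using f by (auto simp: Homeo_plus_def)
  then have "inj f" by (metis UNIV_I homeomorphism_apply1 injI)
  obtain F where cont: "continuous_on UNIV F" and F: "strict_mono F"
    and lift: "to_circle \<circ> F = f \<circ> to_circle"
    using f by (auto simp: Homeo_plus_def orientation_preserving_def)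
  have int: "F x - F y \<in> \<int> \<longleftrightarrow> x - y \<in> \<int>" for x y
    using lift \<open>inj f\<close> by (metis comp_apply injD to_circle_eq_iff)
  have step: "F (x + 1) = F x + 1" for x
  proof -
    have "F (x + 1) - F x \<in> \<int>" by (simp add: int)
    then obtain n where n: "F (x + 1) = F x + of_int n"
      by (metis Ints_cases add.commute diff_add_cancel)
    have "F x < F (x + 1)" using F by (simp add: strict_mono_less)
    then have "n \<ge> 1" using n by simp
    moreover have "n \<le> 1"
    proof (rule ccontr)
      assume "\<not> n \<le> 1"
      then have lt: "F x + 1 < F (x + 1)" using n by simp
      then obtain y where y: "x \<le> y" "y \<le> x + 1" "F y = F x + 1"
        using IVT'[of F x "F x + 1" "x + 1"] cont continuous_on_subset by (metis add_increasing2 less_eq_real_def order_refl subset_UNIV zero_le_one)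
      then have "y \<noteq> x" "y \<noteq> x + 1" using lt by auto
      then have "\<bar>y - x\<bar> < 1" "y - x \<noteq> 0" using y by auto
      moreover have "y - x \<in> \<int>" using int[of y x] y by simp
      ultimately show False using Ints_nonzero_abs_less1 by blast
    qed
    ultimately show ?thesis using n by simp
  qed
  then have deg: "degree_one F"
    using F by (simp add: degree_one_def strict_mono_mono)
  have "surj F"
  proof -
    have "\<exists>x. F x = y" for y
    proof -
      define n where "n = \<lfloor>y - F 0\<rfloor>"
      have "F (of_int n) \<le> y" "y \<le> F (of_int (n + 1))"
        using degree_one_add_int[OF deg, of 0 n] degree_one_add_int[OF deg, of 0 "n + 1"]
        unfolding n_def by simp_all linarith+
      then show ?thesis
        using IVT'[of F "of_int n" y "of_int (n + 1)"] cont continuous_on_subset by force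
    qed
    then show ?thesis by (metis surj_def)
  qed
  have inj: "inj F" using F by (rule strict_mono_imp_inj_on)
  have "homeomorphism UNIV UNIV F (inv_into UNIV F)"
  proof (rule homeomorphismI)
    have "inv_into UNIV F x \<le> inv_into UNIV F y" if "x \<le> y" for x y
    proof -
      have "F (inv_into UNIV F x) \<le> F (inv_into UNIV F y)"
        using that by (simp add: surj_f_inv_f \<open>surj F\<close>)
      then show ?thesis using F by (simp add: strict_mono_less_eq)
    qed
    then show "continuous_on UNIV (inv_into UNIV F)"
      using inj by (intro continuous_onI_mono) (simp_all add: inj_imp_surj_inv)
  qed (use cont inj \<open>surj F\<close> in \<open>auto simp: surj_f_inv_f\<close>)
  then have "F \<in> carrier Homeo_tilde"
    using step by (auto simp: Homeo_tilde_def T_def fun_eq_iff)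
  then show ?thesis using that circle_proj_eqI[OF _ lift[symmetric]] by blast
qed

lemma circle_proj_compose:
  assumes "F \<in> carrier Homeo_tilde" "G \<in> carrier Homeo_tilde"
  shows "circle_proj (F \<circ> G) = circle_proj F \<circ> circle_proj G"
proof (rule circle_proj_eqI)
  show "F \<circ> G \<in> carrier Homeo_tilde"
    using assms by (rule Homeo_tilde_compose_closed)
  show "circle_proj F \<circ> circle_proj G \<circ> to_circle = to_circle \<circ> (F \<circ> G)"
    using assms[THEN circle_proj_to_circle] by (simp add: fun_eq_iff)
qed

lemma circle_proj_id: "circle_proj id = id"
  by (rule circle_proj_eqI) (simp_all add: id_in_Homeo_tilde)

lemma circle_proj_continuous:
  assumes "F \<in> carrier Homeo_tilde"
  shows "continuous_on UNIV (circle_proj F)"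
proof -
  have "open (circle_proj F -` U)" if "open U" for U
  proof -
    have "to_circle -` (circle_proj F -` U) = F -` (to_circle -` U)"
      using circle_proj_to_circle[OF assms] by (simp add: vimage_comp)
    moreover have "open (to_circle -` U)" using that by (simp add: open_circle_def)
    ultimately show ?thesis
      using Homeo_tilde_continuous[OF assms] by (simp add: open_circle_def open_vimage)
  qed
  then show ?thesis by (simp add: continuous_on_open_vimage)
qed

lemma circle_proj_Homeo_plus:
  assumes F: "F \<in> carrier Homeo_tilde"
  shows "circle_proj F \<in> carrier Homeo_plus"
proof -
  obtain F' where F': "F' \<in> carrier Homeo_tilde" and inv: "F' \<circ> F = id" "F \<circ> F' = id"
    using F by (rule Homeo_tilde_inverse)
  have "circle_proj F \<circ> circle_proj F' = id" "circle_proj F' \<circ> circle_proj F = id"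
    using F F' inv circle_proj_compose circle_proj_id by metis+
  then have "homeomorphism UNIV UNIV (circle_proj F) (circle_proj F')"
    using F F' by (intro homeomorphismI circle_proj_continuous) (auto simp: pointfree_idE)
  moreover have "orientation_preserving (circle_proj F)"
    using F circle_proj_to_circle Homeo_tilde_continuous Homeo_tilde_strict_mono
    unfolding orientation_preserving_def by metis
  ultimately show ?thesis by (auto simp: Homeo_plus_def)
qed

lemma circle_proj_hom: "circle_proj \<in> hom Homeo_tilde Homeo_plus"
  by (rule homI) (simp_all add: circle_proj_Homeo_plus circle_proj_compose Homeo_tilde_mult Homeo_plus_mult)

lemma circle_proj_image: "circle_proj ` carrier Homeo_tilde = carrier Homeo_plus"
  using circle_proj_Homeo_plus Homeo_plus_lift by blast

text \<open>As the image of a group under \<open>circle_proj\<close>; in particular, inverses of orientation preserving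
  homeomorphisms preserve the orientation because inverses of their lifts do.\<close>

lemma group_Homeo_plus: "group Homeo_plus"
  using group.hom_imp_img_group[OF group_Homeo_tilde circle_proj_hom]
  by (simp add: circle_proj_image Homeo_tilde_one circle_proj_id Homeo_plus_def)

lemma translation_number_compose_T_int:
  assumes F: "F \<in> carrier Homeo_tilde"
  shows "translation_number (F \<circ> T (of_int n)) = translation_number F + of_int n"
  using translation_number_commuting[OF Homeo_tilde_degree_one[OF F]
      Homeo_tilde_degree_one[OF T_int_in_Homeo_tilde] Homeo_tilde_commute_T_int[OF F]]
  by (simp add: translation_number_T)

text \<open>Changing the lifts by the integer translations \<open>m\<close> and \<open>n\<close>, which are central, changes the
  translation number of the product by \<open>m + n\<close>.\<close>

lemma euler_cocycle_eq:
  assumes F: "F \<in> carrier Homeo_tilde" and G: "G \<in> carrier Homeo_tilde"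
  shows "euler_cocycle (circle_proj F) (circle_proj G) =
    translation_number (F \<circ> G) - translation_number F - translation_number G"
proof -
  have indep: "translation_number (F' \<circ> G') - translation_number F' - translation_number G' =
      translation_number (F \<circ> G) - translation_number F - translation_number G"
    if F': "F' \<in> carrier Homeo_tilde" and G': "G' \<in> carrier Homeo_tilde"
      and eq: "circle_proj F' = circle_proj F" "circle_proj G' = circle_proj G" for F' G'
  proof -
    obtain m where m: "F' = F \<circ> T (of_int m)"
      using eq circle_proj_eq_iff[OF F F'] by metis
    obtain n where n: "G' = G \<circ> T (of_int n)"
      using eq circle_proj_eq_iff[OF G G'] by metis
    have "F' \<circ> G' = F \<circ> G \<circ> T (of_int (m + n))"
      by (simp add: m n fun_eq_iff T_def degree_one_add_int Homeo_tilde_degree_one F G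
          flip: add.assoc of_int_add)
    then have "translation_number (F' \<circ> G') = translation_number (F \<circ> G) + of_int (m + n)"
      by (simp only: translation_number_compose_T_int Homeo_tilde_compose_closed F G)
    then show ?thesis
      by (simp add: m n translation_number_compose_T_int F G)
  qed
  show ?thesis unfolding euler_cocycle_def
  proof (rule the_equality)
    show "\<forall>F' \<in> carrier Homeo_tilde. \<forall>G' \<in> carrier Homeo_tilde.
        circle_proj F' = circle_proj F \<and> circle_proj G' = circle_proj G \<longrightarrow>
        translation_number (F \<circ> G) - translation_number F - translation_number G =
        translation_number (F' \<circ> G') - translation_number F' - translation_number G'"
      by (intro ballI impI indep[symmetric]) simp_all
  qed (use F G in simp)
qed

lemma translation_number_inverse:
  assumes "F \<in> carrier Homeo_tilde" "F' \<in> carrier Homeo_tilde" "F' \<circ> F = id" "F \<circ> F' = id"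
  shows "translation_number F' = - translation_number F"
  using translation_number_commuting[of F' F] assms Homeo_tilde_degree_one translation_number_id by simp

text \<open>The lower bound is the upper bound for the inverses.\<close>

lemma translation_number_defect:
  assumes F: "F \<in> carrier Homeo_tilde" and G: "G \<in> carrier Homeo_tilde"
  shows "\<bar>translation_number (F \<circ> G) - translation_number F - translation_number G\<bar> \<le> 1"
proof -
  obtain F' where F': "F' \<in> carrier Homeo_tilde" "F' \<circ> F = id" "F \<circ> F' = id"
    using F by (rule Homeo_tilde_inverse)
  obtain G' where G': "G' \<in> carrier Homeo_tilde" "G' \<circ> G = id" "G \<circ> G' = id"
    using G by (rule Homeo_tilde_inverse)
  have "(G' \<circ> F') \<circ> (F \<circ> G) = id" "(F \<circ> G) \<circ> (G' \<circ> F') = id"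
    using F' G' by (simp_all add: fun_eq_iff)
  then have "translation_number (G' \<circ> F') = - translation_number (F \<circ> G)"
    using F F' G G' by (intro translation_number_inverse Homeo_tilde_compose_closed)
  moreover have "translation_number (G' \<circ> F') \<le> - translation_number G - translation_number F + 1"
    using translation_number_compose_le[of G' F'] translation_number_inverse[OF F F']
      translation_number_inverse[OF G G'] F' G' by (simp add: Homeo_tilde_degree_one)
  moreover have "translation_number (F \<circ> G) \<le> translation_number F + translation_number G + 1"
    using F G by (intro translation_number_compose_le Homeo_tilde_degree_one)
  ultimately show ?thesis by linarith
qed

lemma euler_cocycle_bound:
  "f \<in> carrier Homeo_plus \<Longrightarrow> g \<in> carrier Homeo_plus \<Longrightarrow> \<bar>euler_cocycle f g\<bar> \<le> 1"
  by (auto elim!: Homeo_plus_lift simp: euler_cocycle_eq translation_number_defect)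


section \<open>The central extension by the reals\<close>

definition ext_class :: "(real \<Rightarrow> real) \<Rightarrow> real \<Rightarrow> ((real \<Rightarrow> real) \<times> real) set" where
  "ext_class F r = ext_rel `` {(F, r)}"

lemma equiv_ext_rel: "equiv UNIV ext_rel"
  unfolding ext_rel_def
  by (rule equivI) (auto intro!: refl_onI symI transI simp: equivclp_sym intro: equivclp_trans)

text \<open>A chain of steps in both directions adds up to a single integer translation.\<close>

lemma ext_rel_iff:
  assumes F: "F \<in> carrier Homeo_tilde"
  shows "((F, r), (G, s)) \<in> ext_rel \<longleftrightarrow> (\<exists>n. G = F \<circ> T (of_int n) \<and> s = r - of_int n)"
proof
  have "\<exists>n. fst y = F \<circ> T (of_int n) \<and> snd y = r - of_int n" if "equivclp ext_step (F, r) y" for y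
    using that
  proof (induction rule: equivclp_induct)
    case base
    show ?case by (rule exI[of _ 0]) (simp add: T_def fun_eq_iff)
  next
    case (step y z)
    then obtain n where n: "fst y = F \<circ> T (of_int n)" "snd y = r - of_int n" by blast
    from step(2) show ?case
    proof
      assume "ext_step y z"
      then show ?thesis using n
        by (intro exI[of _ "n + 1"]) (auto simp: ext_step_def T_def fun_eq_iff algebra_simps)
    next
      assume "ext_step z y"
      then obtain H t where H: "z = (H, t)" "y = (H \<circ> T 1, t - 1)" by (auto simp: ext_step_def)
      have "H x = F (x + of_int (n - 1))" for x
        using fun_cong[OF n(1), of "x - 1"] H by (simp add: T_def algebra_simps)
      then show ?thesis using n H
        by (intro exI[of _ "n - 1"]) (auto simp: T_def fun_eq_iff)
    qed
  qed
  then show "\<exists>n. G = F \<circ> T (of_int n) \<and> s = r - of_int n" if "((F, r), (G, s)) \<in> ext_rel"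
    using that by (fastforce simp: ext_rel_def)
next
  have step: "ext_step (F \<circ> T (of_int n), r - of_int n) (F \<circ> T (of_int (n + 1)), r - of_int (n + 1))" for n
    unfolding ext_step_def using Homeo_tilde_compose_closed[OF F T_int_in_Homeo_tilde]
    by (intro bexI[of _ "F \<circ> T (of_int n)"] exI[of _ "r - of_int n"]) (auto simp: T_def fun_eq_iff algebra_simps)
  have "equivclp ext_step (F, r) (F \<circ> T (of_int n), r - of_int n)" for n
  proof (induction n rule: int_induct[where k = 0])
    case base
    have "F \<circ> T (of_int 0) = F" by (simp add: T_def fun_eq_iff)
    then show ?case by simp
  next
    case (step1 i)
    then show ?case using step[of i] by (meson equivclp_trans r_into_equivclp)
  next
    case (step2 i)
    have "ext_step (F \<circ> T (of_int (i - 1)), r - of_int (i - 1)) (F \<circ> T (of_int i), r - of_int i)"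
      using step[of "i - 1"] by simp
    from equivclp_trans[OF step2(2) equivclp_sym[OF r_into_equivclp[of ext_step, OF this]]]
    show ?case .
  qed
  then show "((F, r), (G, s)) \<in> ext_rel" if "\<exists>n. G = F \<circ> T (of_int n) \<and> s = r - of_int n"
    using that by (auto simp: ext_rel_def)
qed

lemma mem_ext_class_iff:
  "F \<in> carrier Homeo_tilde \<Longrightarrow>
    (G, s) \<in> ext_class F r \<longleftrightarrow> (\<exists>n. G = F \<circ> T (of_int n) \<and> s = r - of_int n)"
  by (simp add: ext_class_def ext_rel_iff)

lemma ext_class_self: "(F, r) \<in> ext_class F r"
  using equiv_class_self[OF equiv_ext_rel, of "(F, r)"] by (simp add: ext_class_def)

lemma ext_class_T_int:
  assumes "F \<in> carrier Homeo_tilde"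
  shows "ext_class (F \<circ> T (of_int n)) (r - of_int n) = ext_class F r"
proof -
  have "((F, r), (F \<circ> T (of_int n), r - of_int n)) \<in> ext_rel"
    using ext_rel_iff[OF assms] by blast
  then show ?thesis
    unfolding ext_class_def using equiv_class_eq[OF equiv_ext_rel] by metis
qed

lemma ext_class_in_carrier: "F \<in> carrier Homeo_tilde \<Longrightarrow> ext_class F r \<in> carrier Homeo_tilde_R"
  by (simp add: Homeo_tilde_R_def ext_class_def quotientI)

lemma Homeo_tilde_R_cases:
  assumes "X \<in> carrier Homeo_tilde_R"
  obtains F r where "F \<in> carrier Homeo_tilde" "X = ext_class F r"
  using assms by (auto simp: Homeo_tilde_R_def ext_class_def elim!: quotientE)

text \<open>Integer translations are central, so all representatives give the same class.\<close>

lemma ext_class_mult: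
  assumes F: "F \<in> carrier Homeo_tilde" and G: "G \<in> carrier Homeo_tilde"
  shows "ext_class F r \<otimes>\<^bsub>Homeo_tilde_R\<^esub> ext_class G s = ext_class (F \<circ> G) (r + s)"
proof -
  have "ext_class (F' \<circ> G') (r' + s') = ext_class (F \<circ> G) (r + s)"
    if F': "(F', r') \<in> ext_class F r" and G': "(G', s') \<in> ext_class G s" for F' r' G' s'
  proof -
    obtain m where m: "F' = F \<circ> T (of_int m)" "r' = r - of_int m"
      using F' mem_ext_class_iff[OF F] by blast
    obtain n where n: "G' = G \<circ> T (of_int n)" "s' = s - of_int n"
      using G' mem_ext_class_iff[OF G] by blast
    have "F' \<circ> G' = F \<circ> G \<circ> T (of_int (m + n))"
      by (simp add: m n fun_eq_iff T_def degree_one_add_int Homeo_tilde_degree_one F G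
          flip: add.assoc of_int_add)
    moreover have "r' + s' = (r + s) - of_int (m + n)" by (simp add: m n)
    ultimately show ?thesis
      using ext_class_T_int[OF Homeo_tilde_compose_closed[OF F G]] by metis
  qed
  then have "(\<Union>(F', r')\<in>ext_class F r. \<Union>(G', s')\<in>ext_class G s. ext_class (F' \<circ> G') (r' + s'))
      = (\<Union>_\<in>ext_class F r. \<Union>_\<in>ext_class G s. ext_class (F \<circ> G) (r + s))"
    by (intro SUP_cong refl) auto
  also have "\<dots> = ext_class (F \<circ> G) (r + s)"
    using ext_class_self[of F r] ext_class_self[of G s] by auto
  finally have "(\<Union>(F', r')\<in>ext_class F r. \<Union>(G', s')\<in>ext_class G s. ext_class (F' \<circ> G') (r' + s'))
      = ext_class (F \<circ> G) (r + s)" .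
  then show ?thesis by (simp add: Homeo_tilde_R_def ext_class_def)
qed

lemma ext_class_one: "\<one>\<^bsub>Homeo_tilde_R\<^esub> = ext_class id 0"
  by (simp add: Homeo_tilde_R_def ext_class_def)

lemma group_Homeo_tilde_R: "group Homeo_tilde_R"
proof (rule groupI)
  fix X assume "X \<in> carrier Homeo_tilde_R"
  then obtain F r where F: "F \<in> carrier Homeo_tilde" and X: "X = ext_class F r"
    by (rule Homeo_tilde_R_cases)
  obtain F' where F': "F' \<in> carrier Homeo_tilde" "F' \<circ> F = id"
    using F by (rule Homeo_tilde_inverse)
  show "\<exists>Y\<in>carrier Homeo_tilde_R. Y \<otimes>\<^bsub>Homeo_tilde_R\<^esub> X = \<one>\<^bsub>Homeo_tilde_R\<^esub>"
    by (rule bexI[of _ "ext_class F' (- r)"])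
      (simp_all add: X F F' ext_class_mult ext_class_one ext_class_in_carrier)
qed (auto elim!: Homeo_tilde_R_cases simp: ext_class_mult ext_class_one ext_class_in_carrier
    Homeo_tilde_compose_closed id_in_Homeo_tilde comp_assoc add.assoc)

lemma ext_class_inv:
  assumes F: "F \<in> carrier Homeo_tilde" "F' \<in> carrier Homeo_tilde" and inv: "F' \<circ> F = id"
  shows "inv\<^bsub>Homeo_tilde_R\<^esub> (ext_class F r) = ext_class F' (- r)"
  by (rule group.inv_equality[OF group_Homeo_tilde_R])
    (simp_all add: F inv ext_class_mult ext_class_one ext_class_in_carrier)

lemma ext_proj_class:
  assumes F: "F \<in> carrier Homeo_tilde"
  shows "ext_proj (ext_class F r) = circle_proj F"
proof -
  have "circle_proj F' = circle_proj F" if mem: "(F', r') \<in> ext_class F r" for F' r'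
  proof -
    obtain n where n: "F' = F \<circ> T (of_int n)" using mem F by (auto simp: mem_ext_class_iff)
    then have "F' \<in> carrier Homeo_tilde"
      using Homeo_tilde_compose_closed[OF F T_int_in_Homeo_tilde] by simp
    from circle_proj_eq_iff[OF F this, THEN iffD2, OF exI, OF n] show ?thesis ..
  qed
  then have all: "\<forall>(F', r')\<in>ext_class F r. circle_proj F = circle_proj F'"
    unfolding case_prod_beta by (metis prod.collapse)
  show ?thesis unfolding ext_proj_def
  proof (rule the_equality)
    show "\<forall>(F', r')\<in>ext_class F r. circle_proj F = circle_proj F'" by (rule all)
    show "z = circle_proj F" if "\<forall>(F', r')\<in>ext_class F r. z = circle_proj F'" for z
      using bspec[OF that ext_class_self] by simp
  qed
qed

lemma tau_R_class:
  assumes F: "F \<in> carrier Homeo_tilde"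
  shows "tau_R (ext_class F r) = translation_number F + r"
proof -
  have "translation_number F' + r' = translation_number F + r" if "(F', r') \<in> ext_class F r" for F' r'
    using that F by (auto simp: mem_ext_class_iff translation_number_compose_T_int)
  then have all: "\<forall>(F', r')\<in>ext_class F r. translation_number F + r = translation_number F' + r'"
    unfolding case_prod_beta by (metis prod.collapse)
  show ?thesis unfolding tau_R_def
  proof (rule the_equality)
    show "\<forall>(F', r')\<in>ext_class F r. translation_number F + r = translation_number F' + r'" by (rule all)
    show "z = translation_number F + r" if "\<forall>(F', r')\<in>ext_class F r. z = translation_number F' + r'" for z
      using bspec[OF that ext_class_self] by simp
  qed
qed

lemma ext_proj_hom: "ext_proj \<in> hom Homeo_tilde_R Homeo_plus"
  by (rule homI) (auto elim!: Homeo_tilde_R_cases simp: ext_class_mult ext_proj_class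
      circle_proj_Homeo_plus circle_proj_compose Homeo_plus_mult Homeo_tilde_compose_closed)

lemma ext_proj_surj:
  assumes "f \<in> carrier Homeo_plus"
  obtains X where "X \<in> carrier Homeo_tilde_R" "ext_proj X = f"
  using Homeo_plus_lift[OF assms] ext_class_in_carrier ext_proj_class that by (metis (no_types))

text \<open>Minus \<open>tau_R\<close>, seen as a cochain on the extension, is a primitive of the pulled back Euler cocycle.
  This identity and the behaviour of \<open>tau_R\<close> under conjugation, inversion and powers
  are all that the main argument uses about \<open>tau_R\<close>.\<close>

lemma euler_cocycle_tau_R:
  "X \<in> carrier Homeo_tilde_R \<Longrightarrow> Y \<in> carrier Homeo_tilde_R \<Longrightarrow>
    euler_cocycle (ext_proj X) (ext_proj Y) = tau_R (X \<otimes>\<^bsub>Homeo_tilde_R\<^esub> Y) - tau_R X - tau_R Y"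
  by (auto elim!: Homeo_tilde_R_cases simp: ext_class_mult ext_proj_class tau_R_class
      euler_cocycle_eq Homeo_tilde_compose_closed)

lemma tau_R_inv:
  assumes "X \<in> carrier Homeo_tilde_R"
  shows "tau_R (inv\<^bsub>Homeo_tilde_R\<^esub> X) = - tau_R X"
proof -
  obtain F r where F: "F \<in> carrier Homeo_tilde" and X: "X = ext_class F r"
    using assms by (rule Homeo_tilde_R_cases)
  obtain F' where F': "F' \<in> carrier Homeo_tilde" "F' \<circ> F = id" "F \<circ> F' = id"
    using F by (rule Homeo_tilde_inverse)
  show ?thesis
    using F F' translation_number_inverse[OF F F'] by (simp add: X ext_class_inv tau_R_class)
qed

text \<open>The representative of the power is a power of \<open>F\<close>. The induction only retains that it commutes
  with \<open>F\<close>, which makes translation numbers add up.\<close>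

lemma tau_R_nat_pow:
  assumes X: "X \<in> carrier Homeo_tilde_R"
  shows "tau_R (X [^]\<^bsub>Homeo_tilde_R\<^esub> (n :: nat)) = real n * tau_R X"
proof -
  obtain F r where F: "F \<in> carrier Homeo_tilde" and X: "X = ext_class F r"
    using assms by (rule Homeo_tilde_R_cases)
  have "\<exists>H \<in> carrier Homeo_tilde. X [^]\<^bsub>Homeo_tilde_R\<^esub> n = ext_class H (real n * r) \<and>
      H \<circ> F = F \<circ> H \<and> translation_number H = real n * translation_number F"
  proof (induction n)
    case 0
    show ?case
      by (rule bexI[OF _ id_in_Homeo_tilde]) (simp add: ext_class_one id_def translation_number_id[unfolded id_def])
  next
    case (Suc n)
    then obtain H where H: "H \<in> carrier Homeo_tilde"
      "X [^]\<^bsub>Homeo_tilde_R\<^esub> n = ext_class H (real n * r)" "H \<circ> F = F \<circ> H"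
      "translation_number H = real n * translation_number F" by blast
    have "X [^]\<^bsub>Homeo_tilde_R\<^esub> Suc n = ext_class (H \<circ> F) (real (Suc n) * r)"
      using H F by (simp add: X ext_class_mult distrib_right add.commute)
    moreover have "translation_number (H \<circ> F) = real (Suc n) * translation_number F"
      using translation_number_commuting[OF _ _ H(3)] H F
      by (simp add: Homeo_tilde_degree_one distrib_right)
    moreover have "(H \<circ> F) \<circ> F = F \<circ> (H \<circ> F)"
      using H(3) by (simp add: fun_eq_iff)
    ultimately show ?case
      using Homeo_tilde_compose_closed[OF H(1) F] by blast
  qed
  then show ?thesis using F by (auto simp: tau_R_class X distrib_left)
qed

lemma tau_R_conj:
  assumes "X \<in> carrier Homeo_tilde_R" "Y \<in> carrier Homeo_tilde_R"
  shows "tau_R (X \<otimes>\<^bsub>Homeo_tilde_R\<^esub> Y \<otimes>\<^bsub>Homeo_tilde_R\<^esub> inv\<^bsub>Homeo_tilde_R\<^esub> X) = tau_R Y"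
proof -
  obtain F r where F: "F \<in> carrier Homeo_tilde" and X: "X = ext_class F r"
    using assms(1) by (rule Homeo_tilde_R_cases)
  obtain G s where G: "G \<in> carrier Homeo_tilde" and Y: "Y = ext_class G s"
    using assms(2) by (rule Homeo_tilde_R_cases)
  obtain F' where F': "F' \<in> carrier Homeo_tilde" "F' \<circ> F = id" "F \<circ> F' = id"
    using F by (rule Homeo_tilde_inverse)
  have "F \<circ> G = (F \<circ> G \<circ> F') \<circ> F" using F' by (simp add: comp_assoc)
  then have "translation_number (F \<circ> G \<circ> F') = translation_number G"
    using F G F' by (intro translation_number_semiconj[of F])
      (simp_all add: Homeo_tilde_degree_one degree_one_compose)
  then show ?thesis
    using F G F' by (simp add: X Y ext_class_inv ext_class_mult tau_R_class Homeo_tilde_compose_closed)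
qed


section \<open>Primitives on a normal subgroup\<close>

lemma ordered_prod_0: "ordered_prod G x 0 = \<one>\<^bsub>G\<^esub>"
  by (simp add: ordered_prod_def)

lemma (in monoid) ordered_prod_Suc:
  assumes "\<And>i. i \<in> {1..Suc k} \<Longrightarrow> x i \<in> carrier G"
  shows "ordered_prod G x (Suc k) = ordered_prod G x k \<otimes> x (Suc k)"
proof -
  have "foldr (\<otimes>) xs a \<in> carrier G \<and> foldr (\<otimes>) xs a = foldr (\<otimes>) xs \<one> \<otimes> a \<and> foldr (\<otimes>) xs \<one> \<in> carrier G"
    if "set xs \<subseteq> carrier G" "a \<in> carrier G" for xs a
    using that by (induction xs) (simp_all add: m_assoc)
  moreover have "set (map x [1..<Suc k]) \<subseteq> carrier G" "x (Suc k) \<in> carrier G"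
    using assms by auto
  ultimately have "foldr (\<otimes>) (map x [1..<Suc k]) (x (Suc k)) =
      foldr (\<otimes>) (map x [1..<Suc k]) \<one> \<otimes> x (Suc k)"
    by blast
  moreover have "[1..<Suc (Suc k)] = [1..<Suc k] @ [Suc k]"
    by simp
  ultimately show ?thesis
    using \<open>x (Suc k) \<in> carrier G\<close>
    by (simp add: ordered_prod_def del: upt_Suc)
qed

text \<open>The algebra of the proof, free of circle dynamics. In the application \<open>K\<close> is the central
  extension \<open>Homeo_tilde_R\<close> of \<open>P = Homeo_plus\<close>, \<open>t\<close> is \<open>tau_R\<close> and \<open>e\<close> is the Euler cocycle. The pullback
  of the normalized cocycle \<open>A\<close> vanishes as soon as one argument is in \<open>N\<close>, and \<open>primitive\<close> is what
  then remains of the equation between \<open>u\<close>, \<open>A\<close> and the Euler cocycle.\<close>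

locale equivariant_primitive =
  normal N G + proj: group_hom K P \<pi> + rep: group_hom G P \<rho>
  for N and G :: "('g, 'gx) monoid_scheme" (structure)
    and K :: "('k, 'kx) monoid_scheme" and P :: "('p, 'px) monoid_scheme" and \<pi> and \<rho> +
  fixes t :: "'k \<Rightarrow> real" and e :: "'p \<Rightarrow> 'p \<Rightarrow> real" and u :: "'g \<Rightarrow> real"
  assumes lift: "f \<in> carrier P \<Longrightarrow> \<exists>X \<in> carrier K. \<pi> X = f"
    and cocycle: "X \<in> carrier K \<Longrightarrow> Y \<in> carrier K \<Longrightarrow>
      e (\<pi> X) (\<pi> Y) = t (X \<otimes>\<^bsub>K\<^esub> Y) - t X - t Y"
    and bound: "f \<in> carrier P \<Longrightarrow> f' \<in> carrier P \<Longrightarrow> \<bar>e f f'\<bar> \<le> 1"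
    and t_conj: "X \<in> carrier K \<Longrightarrow> Y \<in> carrier K \<Longrightarrow>
      t (X \<otimes>\<^bsub>K\<^esub> Y \<otimes>\<^bsub>K\<^esub> inv\<^bsub>K\<^esub> X) = t Y"
    and t_inv: "X \<in> carrier K \<Longrightarrow> t (inv\<^bsub>K\<^esub> X) = - t X"
    and t_pow: "X \<in> carrier K \<Longrightarrow> t (X [^]\<^bsub>K\<^esub> (n :: nat)) = real n * t X"
    and primitive: "x \<in> carrier G \<Longrightarrow> y \<in> carrier G \<Longrightarrow> x \<in> N \<or> y \<in> N \<Longrightarrow>
      e (\<rho> x) (\<rho> y) = u y - u (x \<otimes> y) + u x"
begin

lemma obtain_lift:
  assumes "x \<in> carrier G"
  obtains X where "X \<in> carrier K" "\<pi> X = \<rho> x"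
  using lift assms rep.hom_closed by blast

text \<open>Where one factor is in \<open>N\<close>, \<open>u\<close> and \<open>- t\<close> have the same coboundary: that of
  both is the Euler cocycle.\<close>

lemma u_mult:
  assumes "x \<in> carrier G" "y \<in> carrier G" "x \<in> N \<or> y \<in> N"
    and "X \<in> carrier K" "\<pi> X = \<rho> x" "Y \<in> carrier K" "\<pi> Y = \<rho> y"
  shows "u (x \<otimes> y) = u x + u y - (t (X \<otimes>\<^bsub>K\<^esub> Y) - t X - t Y)"
  using primitive[OF assms(1-3)] cocycle[OF assms(4,6)] assms by simp

text \<open>With \<open>z = g x g\<^sup>-\<^sup>1\<close> one has \<open>z g = g x\<close>. Applying \<open>u_mult\<close> to both sides of this equation, with lifts that satisfy the same
  equation, expresses \<open>u z - u x\<close> as the negative of the corresponding difference for \<open>t\<close>, which is conjugation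
  invariant.\<close>

lemma u_conj:
  assumes g: "g \<in> carrier G" and x: "x \<in> N"
  shows "u (g \<otimes> x \<otimes> inv g) = u x"
proof -
  obtain X Y where X: "X \<in> carrier K" "\<pi> X = \<rho> g" and Y: "Y \<in> carrier K" "\<pi> Y = \<rho> x"
    using obtain_lift g x mem_carrier by metis
  define Z where "Z = X \<otimes>\<^bsub>K\<^esub> Y \<otimes>\<^bsub>K\<^esub> inv\<^bsub>K\<^esub> X"
  define z where "z = g \<otimes> x \<otimes> inv g"
  have z: "z \<in> N" unfolding z_def using g x by (rule inv_op_closed2)
  have Z: "Z \<in> carrier K" "\<pi> Z = \<rho> z"
    using X Y g x by (simp_all add: Z_def z_def)
  have "z \<otimes> g = g \<otimes> x" "Z \<otimes>\<^bsub>K\<^esub> X = X \<otimes>\<^bsub>K\<^esub> Y"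
    using X Y g x by (simp_all add: z_def Z_def m_assoc proj.G.m_assoc)
  moreover have "t Z = t Y" unfolding Z_def using X Y by (simp add: t_conj)
  ultimately show ?thesis
    using u_mult[of z g Z X] u_mult[of g x X Y] X Y Z g x z by (simp add: z_def)
qed

lemma t_one: "t \<one>\<^bsub>K\<^esub> = 0"
  using t_pow[of "\<one>\<^bsub>K\<^esub>" 0] by simp

lemma u_one: "u \<one> = 0"
  using u_mult[of \<one> \<one> "\<one>\<^bsub>K\<^esub>" "\<one>\<^bsub>K\<^esub>"] t_one by simp

lemma u_inv:
  assumes "x \<in> N" shows "u (inv x) = - u x"
proof -
  obtain X where "X \<in> carrier K" "\<pi> X = \<rho> x"
    using obtain_lift[OF mem_carrier[OF assms]] by blast
  then show ?thesis
    using u_mult[of x "inv x" X "inv\<^bsub>K\<^esub> X"] assms by (simp add: t_inv t_one u_one)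
qed

lemma u_nat_pow:
  assumes "x \<in> N" shows "u (x [^] (n :: nat)) = real n * u x"
proof (induction n)
  case 0
  show ?case by (simp add: u_one)
next
  case (Suc n)
  obtain X where X: "X \<in> carrier K" "\<pi> X = \<rho> x"
    using obtain_lift[OF mem_carrier[OF assms]] by blast
  have "t (X [^]\<^bsub>K\<^esub> n \<otimes>\<^bsub>K\<^esub> X) = t (X [^]\<^bsub>K\<^esub> n) + t X"
    using t_pow[OF X(1), of "Suc n"] t_pow[OF X(1), of n] by (simp add: algebra_simps)
  then show ?case
    using u_mult[of "x [^] n" x "X [^]\<^bsub>K\<^esub> n" X] X assms Suc
    by (simp add: proj.hom_nat_pow rep.hom_nat_pow algebra_simps)
qed

lemma u_int_pow:
  assumes "x \<in> N" shows "u (x [^] (n :: int)) = of_int n * u x"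
proof (cases n)
  case (nonneg m)
  then show ?thesis using u_nat_pow[OF assms] by (simp add: int_pow_int)
next
  case (neg m)
  have "x [^] Suc m \<in> N" 
    using assms by (induction m) simp_all
  then show ?thesis
    using u_nat_pow[OF assms, of "Suc m"] u_inv assms neg
    by (simp add: int_pow_neg_int del: nat_pow_Suc of_nat_Suc)
qed

text \<open>Here \<open>[g, w]\<close> is the product of the conjugate \<open>g w g\<^sup>-\<^sup>1\<close> and of \<open>w\<^sup>-\<^sup>1\<close>, both of them in \<open>N\<close>. On these two
  factors the values of \<open>u\<close> are \<open>u w\<close> and \<open>- u w\<close> and cancel, and so do those of \<open>t\<close> on the lifts; only the
  values on the commutators themselves are left in \<open>u_mult\<close>.\<close>

lemma u_commutator:
  assumes g: "g \<in> carrier G" and w: "w \<in> N"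
    and X: "X \<in> carrier K" "\<pi> X = \<rho> g" and Y: "Y \<in> carrier K" "\<pi> Y = \<rho> w"
  shows "commutator G g w \<in> N" "commutator K X Y \<in> carrier K"
    "\<pi> (commutator K X Y) = \<rho> (commutator G g w)"
    "u (commutator G g w) = - t (commutator K X Y)"
proof -
  have c: "g \<otimes> w \<otimes> inv g \<in> N" using g w by (rule inv_op_closed2)
  show "commutator G g w \<in> N" using c w by (simp add: commutator_def)
  show "commutator K X Y \<in> carrier K" using X Y by (simp add: commutator_def)
  show "\<pi> (commutator K X Y) = \<rho> (commutator G g w)"
    using X Y g w by (simp add: commutator_def)
  show "u (commutator G g w) = - t (commutator K X Y)"
    unfolding commutator_def
    using u_mult[of "g \<otimes> w \<otimes> inv g" "inv w" "X \<otimes>\<^bsub>K\<^esub> Y \<otimes>\<^bsub>K\<^esub> inv\<^bsub>K\<^esub> X" "inv\<^bsub>K\<^esub> Y"] c X Y g w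
    by (simp add: t_conj t_inv u_conj u_inv)
qed

text \<open>The equation \<open>u x = - t X\<close> singles out, among the lifts of \<open>x\<close>, those for which the
  correction terms in \<open>u_mult\<close> cancel, so it passes to products. It holds for a commutator whatever lifts it is
  formed from.\<close>

lemma u_ordered_prod:
  assumes "\<And>i. i \<in> {1..k} \<Longrightarrow> x i \<in> N \<and> X i \<in> carrier K \<and> \<pi> (X i) = \<rho> (x i) \<and> u (x i) = - t (X i)"
  shows "ordered_prod G x k \<in> N \<and> ordered_prod K X k \<in> carrier K \<and>
    \<pi> (ordered_prod K X k) = \<rho> (ordered_prod G x k) \<and>
    u (ordered_prod G x k) = - t (ordered_prod K X k)"
  using assms
proof (induction k)
  case 0
  show ?case by (simp add: ordered_prod_0 u_one t_one)
next
  case (Suc k)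
  have last: "x (Suc k) \<in> N" "X (Suc k) \<in> carrier K" "\<pi> (X (Suc k)) = \<rho> (x (Suc k))"
    "u (x (Suc k)) = - t (X (Suc k))"
    using Suc.prems by simp_all
  have step: "ordered_prod G x (Suc k) = ordered_prod G x k \<otimes> x (Suc k)"
    "ordered_prod K X (Suc k) = ordered_prod K X k \<otimes>\<^bsub>K\<^esub> X (Suc k)"
    by (rule ordered_prod_Suc proj.G.ordered_prod_Suc, use Suc.prems mem_carrier in blast)+
  show ?case
    using Suc.IH Suc.prems last
      u_mult[of "ordered_prod G x k" "x (Suc k)" "ordered_prod K X k" "X (Suc k)"]
    unfolding step by simp
qed

lemma homogeneous_quasimorphism_restrict:
  "homogeneous_quasimorphism (G\<lparr>carrier := N\<rparr>) (restrict u N)"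
  "defect (G\<lparr>carrier := N\<rparr>) (restrict u N) \<le> 1"
proof -
  have dev: "d \<le> 1" if "d \<in> deviations (G\<lparr>carrier := N\<rparr>) (restrict u N)" for d
  proof -
    obtain x y where x: "x \<in> N" and y: "y \<in> N" and d: "d = \<bar>u (x \<otimes> y) - u x - u y\<bar>"
      using \<open>d \<in> _\<close> by (auto simp: deviations_def)
    have "d = \<bar>e (\<rho> x) (\<rho> y)\<bar>"
      using primitive[of x y] x y by (simp add: d)
    then show ?thesis using bound x y by simp
  qed
  have pow: "x [^]\<^bsub>G\<lparr>carrier := N\<rparr>\<^esub> n \<in> N \<and> x [^]\<^bsub>G\<lparr>carrier := N\<rparr>\<^esub> n = x [^] n"
    if "x \<in> N" for x and n :: int
    using group.int_pow_closed[OF subgroup_imp_group[OF is_subgroup]]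
      int_pow_consistent[OF is_subgroup] that by simp
  show "homogeneous_quasimorphism (G\<lparr>carrier := N\<rparr>) (restrict u N)"
    unfolding homogeneous_quasimorphism_def
  proof (intro conjI ballI allI)
    show "bdd_above (deviations (G\<lparr>carrier := N\<rparr>) (restrict u N))"
      using dev by (rule bdd_aboveI)
    show "restrict u N (x [^]\<^bsub>G\<lparr>carrier := N\<rparr>\<^esub> n) = of_int n * restrict u N x"
      if "x \<in> carrier (G\<lparr>carrier := N\<rparr>)" for x and n :: int
    proof -
      have "x \<in> N" using that by simp
      from pow[OF this, of n] u_int_pow[OF this, of n] this show ?thesis
        by (metis restrict_apply')
    qed
  qed
  have "\<one> \<in> carrier (G\<lparr>carrier := N\<rparr>)"
    using subgroup.one_closed[OF is_subgroup] by simp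
  then have "deviations (G\<lparr>carrier := N\<rparr>) (restrict u N) \<noteq> {}"
    unfolding deviations_def by blast
  then show "defect (G\<lparr>carrier := N\<rparr>) (restrict u N) \<le> 1"
    unfolding defect_def using dev by (rule cSup_least)
qed

lemma invariant_restrict: "invariant_under G N (restrict u N)"
  unfolding invariant_under_def using u_conj inv_op_closed2 by simp

end


section \<open>The restriction of the primitive to the normal subgroup\<close>

theorem theorem3p6:
  fixes G :: "('g, 'm) monoid_scheme"
    and N :: "'g set"
    and p :: "'g \<Rightarrow> 'g set"
    and \<rho> :: "'g \<Rightarrow> circle \<Rightarrow> circle"
    and A :: "'g set \<Rightarrow> 'g set \<Rightarrow> real"
    and u \<mu> :: "'g \<Rightarrow> real"
  assumes "group G"
    and "N \<lhd> G"
    and "p = (\<lambda>g. N #>\<^bsub>G\<^esub> g)"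
    and "\<rho> \<in> hom G Homeo_plus"
    and "H2_pullback G \<rho> real_euler_class \<in> H2_pullback G p ` H2 (G Mod N)"
    and "normalized_cocycle2 (G Mod N) A"
    and "\<forall>g \<in> carrier G. \<forall>h \<in> carrier G.
           pullback2 \<rho> euler_cocycle g h - pullback2 p A g h = coboundary1 G u g h"
    and "\<mu> = restrict u N"
  shows "(homogeneous_quasimorphism (G\<lparr>carrier := N\<rparr>) \<mu>
            \<and> invariant_under G N \<mu>
            \<and> defect (G\<lparr>carrier := N\<rparr>) \<mu> \<le> 1)
       \<and> (\<forall>k::nat. \<forall>g w :: nat \<Rightarrow> 'g. \<forall>g' w' :: nat \<Rightarrow> ((real \<Rightarrow> real) \<times> real) set.
            0 < k \<longrightarrow>
            (\<forall>i \<in> {1..k}.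
               g i \<in> carrier G \<and> w i \<in> N \<and>
               g' i \<in> carrier Homeo_tilde_R \<and> ext_proj (g' i) = \<rho> (g i) \<and>
               w' i \<in> carrier Homeo_tilde_R \<and> ext_proj (w' i) = \<rho> (w i)) \<longrightarrow>
            \<mu> (ordered_prod G (\<lambda>i. commutator G (g i) (w i)) k) =
              - tau_R (ordered_prod Homeo_tilde_R
                         (\<lambda>i. commutator Homeo_tilde_R (g' i) (w' i)) k))"
proof -
  interpret normal N G by (rule assms(2))
  interpret equivariant_primitive N G Homeo_tilde_R Homeo_plus ext_proj \<rho> tau_R euler_cocycle u
  proof (intro equivariant_primitive.intro equivariant_primitive_axioms.intro)
    show "group_hom Homeo_tilde_R Homeo_plus ext_proj"
      by (simp add: group_hom_def group_hom_axioms_def group_Homeo_tilde_R group_Homeo_plus ext_proj_hom)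
    show "group_hom G Homeo_plus \<rho>"
      by (simp add: group_hom_def group_hom_axioms_def assms(1,4) group_Homeo_plus)
    fix x y assume x: "x \<in> carrier G" and y: "y \<in> carrier G" and N: "x \<in> N \<or> y \<in> N"
    \<comment> \<open>One of the arguments of \<open>A\<close> is the identity coset, where \<open>A\<close> vanishes.\<close>
    have carr: "p z \<in> carrier (G Mod N)" if "z \<in> carrier G" for z
      using that subset by (auto simp: FactGroup_def assms(3) intro: rcosetsI)
    have "p z = \<one>\<^bsub>G Mod N\<^esub>" if "z \<in> N" for z
      using that by (simp add: FactGroup_def assms(3) rcos_const is_group)
    then have "A (p x) (p y) = 0"
      using N assms(6) carr x y unfolding normalized_cocycle2_def by metis
    then show "euler_cocycle (\<rho> x) (\<rho> y) = u y - u (x \<otimes>\<^bsub>G\<^esub> y) + u x"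
      using assms(7)[rule_format, OF x y] by (simp add: pullback2_def coboundary1_def)
  qed (use ext_proj_surj in \<open>auto intro: normal_axioms euler_cocycle_tau_R euler_cocycle_bound
      tau_R_conj tau_R_inv tau_R_nat_pow\<close>)
  have "\<mu> (ordered_prod G (\<lambda>i. commutator G (g i) (w i)) k) =
      - tau_R (ordered_prod Homeo_tilde_R (\<lambda>i. commutator Homeo_tilde_R (g' i) (w' i)) k)"
    if lifts: "\<forall>i \<in> {1..k}. g i \<in> carrier G \<and> w i \<in> N \<and>
        g' i \<in> carrier Homeo_tilde_R \<and> ext_proj (g' i) = \<rho> (g i) \<and>
        w' i \<in> carrier Homeo_tilde_R \<and> ext_proj (w' i) = \<rho> (w i)" for k g w g' w'
  proof -
    have "commutator G (g i) (w i) \<in> N \<and>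
        commutator Homeo_tilde_R (g' i) (w' i) \<in> carrier Homeo_tilde_R \<and>
        ext_proj (commutator Homeo_tilde_R (g' i) (w' i)) = \<rho> (commutator G (g i) (w i)) \<and>
        u (commutator G (g i) (w i)) = - tau_R (commutator Homeo_tilde_R (g' i) (w' i))"
      if "i \<in> {1..k}" for i
      using u_commutator[of "g i" "w i" "g' i" "w' i"] lifts that by blast
    then have "ordered_prod G (\<lambda>i. commutator G (g i) (w i)) k \<in> N \<and>
      u (ordered_prod G (\<lambda>i. commutator G (g i) (w i)) k) =
      - tau_R (ordered_prod Homeo_tilde_R (\<lambda>i. commutator Homeo_tilde_R (g' i) (w' i)) k)"
      using u_ordered_prod[of k "\<lambda>i. commutator G (g i) (w i)"
          "\<lambda>i. commutator Homeo_tilde_R (g' i) (w' i)"] by blast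
    then show ?thesis by (simp add: assms(8))
  qed
  then show ?thesis
    using homogeneous_quasimorphism_restrict invariant_restrict assms(8) by blast
qed

end
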